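(* Let $\psi$ be a QCBF instance and let $(\phi,\mathbf{B})$ be a QCSP translation of $\psi$ (with $I_\phi=I_\psi$). For each clause judgement proof of $\psi$ of length $s$ and width $w$, there exists a constraint judgement proof of $(\phi,\mathbf{B})$ of length at most $2s$ and width at most $w+1$ such that for each clause judgement $(i,\alpha)$ appearing in the first proof there is a constraint judgement in the second proof of the form $(i,\mathrm{vars}(\alpha),F)$ such that every $f\in F$ satisfies $\alpha$ (equivalently, the unique $g:\mathrm{vars}(\alpha)\to\{0,1\}$ not satisfying $\alpha$ is not in $F$).
   Context: Propositional side. A literal is a variable $v$ or its negation $\overline{v}$; $v,\overline{v}$ are complementary. A clause is a disjunction of literals with at most one literal on each variable (also a set of literals); $\mathrm{vars}(\alpha)$ is its set of variables. $\gamma$ is a resolvent of $\alpha,\beta$ if there is $L\in\alpha$ with complement $M\in\beta$ and $\gamma=(\alpha\setminus\{L\})\cup(\beta\setminus\{M\})$ is a clause. A QCBF instance is a propositional formula without free variables built from clauses, conjunction and $\forall/\exists$ quantification; $I_\psi$ has one index per subformula occurrence (a clause has no proper subformulas), $\psi(i)$ is the subformula at $i$, parent/child refer to the syntax tree. A clause judgement is $(i,\alpha)$ with $\mathrm{vars}(\alpha)\subseteq\mathrm{free}(\psi(i))$; its width is $|\mathrm{vars}(\alpha)|$. A clause judgement proof is a finite sequence of clause judgements each of one of the types: (clause) $(i,\alpha)$ with $\psi(i)$ the clause $\alpha$; (resolve) $(i,\gamma)$ from previous $(i,\alpha),(i,\beta)$ with $\gamma$ a resolvent of $\alpha,\beta$;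 (upward flow) $(i,\alpha)$ from previous $(j,\alpha)$, $i$ the parent of $j$; ($\forall$-removal) $(i,\alpha\setminus\{y,\overline{y}\})$ from previous $(j,\alpha)$ with $\psi(i)=\forall y\,\psi(j)$, $i$ parent of $j$; (downward flow) $(j,\alpha)$ from previous $(i,\alpha)$, $i$ parent of $j$. QCSP side. A qc-formula is built from relational atoms, conjunction, $\forall,\exists$; $I_\phi$, $\phi(i)$, parent/child as for syntax trees. A constraint judgement is $(i,V,F)$ with $V\subseteq\mathrm{free}(\phi(i))$ and $F$ a set of maps $V\to B$; width $|V|$. With $F_1\Join F_2=\{f:U_1\cup U_2\to B: f\upharpoonright U_1\in F_1, f\upharpoonright U_2\in F_2\}$ and, for $y\in U$, $\epsilon_yF=\{f:U\setminus\{y\}\to B: f[y\to b]\in F$ for all $b\}$, a constraint judgement proof is a finite sequence of constraint judgements each of type: (atom) $(i,\{v_1,\dots,v_k\},F)$, $\phi(i)=R(v_1,\dots,v_k)$, $F=\{f:(f(v_1),\dots,f(v_k))\in R^{\mathbf{B}}\}$; (projection) $(i,U,F\upharpoonright U)$ from previous $(i,V,F)$, $U\subseteq V$; (join) $(i,U_1\cup U_2,F_1\Join F_2)$ from previous $(i,U_1,F_1),(i,U_2,F_2)$; (upward flow) $(i,V,F)$ from previous $(j,V,F)$, $i$ parent of $j$; ($\forall$-elimination) $(i,V\setminus\{y\},\epsilon_yF)$ from previous $(j,V,F)$, $y\in V$, $\phi(i)=\forall y\,\phi(j)$, $i$ parent of $j$; (downward flow) $(j,V,F)$ from previous $(i,V,F)$,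 $i$ parent of $j$. For both kinds of proofs, length is the number of judgements and width is the maximum width of its judgements. A QCSP translation of $\psi$ is $(\phi,\mathbf{B})$ with $\mathbf{B}$ one-sorted with universe $\{0,1\}$ and $\phi$ obtained from $\psi$ by replacing each clause $\gamma$ with variables $v_1,\dots,v_k$ by an atom $R(v_1,\dots,v_k)$ with $R^{\mathbf{B}}=\{(f(v_1),\dots,f(v_k)) : f \text{ satisfies } \gamma\}$; corresponding subformulas of $\phi$ and $\psi$ share indices. *)

theory Defs
  imports Main "HOL-Library.FuncSet"
begin

text \<open>
  QCBF instances and qc-formulas are both instances of one type of syntax trees; they differ only
  in what sits at the leaves (clauses, respectively relational atoms).
\<close>

datatype ('v, leaves: 'a) qformula =
    Leaf 'a
  | And "('v, 'a) qformula" "('v, 'a) qformula"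
  | Forall 'v "('v, 'a) qformula"
  | Exists 'v "('v, 'a) qformula"

primrec free :: "('a \<Rightarrow> 'v set) \<Rightarrow> ('v, 'a) qformula \<Rightarrow> 'v set" where
  "free vs (Leaf a) = vs a"
| "free vs (And \<phi> \<chi>) = free vs \<phi> \<union> free vs \<chi>"
| "free vs (Forall y \<phi>) = free vs \<phi> - {y}"
| "free vs (Exists y \<phi>) = free vs \<phi> - {y}"

text \<open>
  A subformula occurrence is addressed by the path leading to it from the root, each step giving
  the number of the child taken. Trees of the same shape thus have the same index set.
\<close>

type_synonym index = "nat list"

primrec children :: "('v, 'a) qformula \<Rightarrow> ('v, 'a) qformula list" where
  "children (Leaf a) = []"
| "children (And \<phi> \<chi>) = [\<phi>, \<chi>]"
| "children (Forall y \<phi>) = [\<phi>]"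
| "children (Exists y \<phi>) = [\<phi>]"

primrec subformula_at :: "index \<Rightarrow> ('v, 'a) qformula \<Rightarrow> ('v, 'a) qformula option" where
  "subformula_at [] \<phi> = Some \<phi>"
| "subformula_at (d # p) \<phi> =
     (if d < length (children \<phi>) then subformula_at p (children \<phi> ! d) else None)"

definition indices :: "('v, 'a) qformula \<Rightarrow> index set" where
  "indices \<phi> = {i. subformula_at i \<phi> \<noteq> None}"

definition is_parent :: "('v, 'a) qformula \<Rightarrow> index \<Rightarrow> index \<Rightarrow> bool" where
  "is_parent \<phi> i j \<longleftrightarrow> i \<in> indices \<phi> \<and> j \<in> indices \<phi> \<and> (\<exists>d. j = i @ [d])"


subsection \<open>Clauses and clause judgement proofs\<close>

datatype 'v literal = Pos 'v | Neg 'v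

primrec complement :: "'v literal \<Rightarrow> 'v literal" where
  "complement (Pos v) = Neg v"
| "complement (Neg v) = Pos v"

primrec var :: "'v literal \<Rightarrow> 'v" where
  "var (Pos v) = v"
| "var (Neg v) = v"

type_synonym 'v clause = "'v literal set"

definition is_clause :: "'v clause \<Rightarrow> bool" where
  "is_clause \<alpha> \<longleftrightarrow> finite \<alpha> \<and> (\<forall>L\<in>\<alpha>. \<forall>M\<in>\<alpha>. var L = var M \<longrightarrow> L = M)"

definition vars :: "'v clause \<Rightarrow> 'v set" where
  "vars \<alpha> = var ` \<alpha>"

primrec literal_true :: "('v \<Rightarrow> bool) \<Rightarrow> 'v literal \<Rightarrow> bool" where
  "literal_true f (Pos v) \<longleftrightarrow> f v"
| "literal_true f (Neg v) \<longleftrightarrow> \<not> f v"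

definition satisfies :: "('v \<Rightarrow> bool) \<Rightarrow> 'v clause \<Rightarrow> bool" where
  "satisfies f \<alpha> \<longleftrightarrow> (\<exists>L\<in>\<alpha>. literal_true f L)"

definition resolvent :: "'v clause \<Rightarrow> 'v clause \<Rightarrow> 'v clause \<Rightarrow> bool" where
  "resolvent \<alpha> \<beta> \<gamma> \<longleftrightarrow>
     (\<exists>L\<in>\<alpha>. complement L \<in> \<beta> \<and> \<gamma> = (\<alpha> - {L}) \<union> (\<beta> - {complement L}) \<and> is_clause \<gamma>)"

type_synonym 'v qcbf = "('v, 'v clause) qformula"

definition qcbf_instance :: "'v qcbf \<Rightarrow> bool" where
  "qcbf_instance \<psi> \<longleftrightarrow> (\<forall>\<gamma>\<in>leaves \<psi>. is_clause \<gamma>) \<and> free vars \<psi> = {}"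

type_synonym 'v cl_judgement = "index \<times> 'v clause"

definition clause_judgement :: "'v qcbf \<Rightarrow> 'v cl_judgement \<Rightarrow> bool" where
  "clause_judgement \<psi> = (\<lambda>(i, \<alpha>).
     is_clause \<alpha> \<and> (\<exists>\<chi>. subformula_at i \<psi> = Some \<chi> \<and> vars \<alpha> \<subseteq> free vars \<chi>))"

inductive clause_step :: "'v qcbf \<Rightarrow> 'v cl_judgement set \<Rightarrow> 'v cl_judgement \<Rightarrow> bool"
  for \<psi> :: "'v qcbf" and previous :: "'v cl_judgement set" where
  clause: "subformula_at i \<psi> = Some (Leaf \<alpha>) \<Longrightarrow> clause_step \<psi> previous (i, \<alpha>)"
| resolve: "\<lbrakk>(i, \<alpha>) \<in> previous; (i, \<beta>) \<in> previous; resolvent \<alpha> \<beta> \<gamma>\<rbrakk>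
    \<Longrightarrow> clause_step \<psi> previous (i, \<gamma>)"
| upward_flow: "\<lbrakk>(j, \<alpha>) \<in> previous; is_parent \<psi> i j\<rbrakk> \<Longrightarrow> clause_step \<psi> previous (i, \<alpha>)"
| forall_removal: "\<lbrakk>(j, \<alpha>) \<in> previous; is_parent \<psi> i j;
      subformula_at i \<psi> = Some (Forall y \<chi>); subformula_at j \<psi> = Some \<chi>\<rbrakk>
    \<Longrightarrow> clause_step \<psi> previous (i, \<alpha> - {Pos y, Neg y})"
| downward_flow: "\<lbrakk>(i, \<alpha>) \<in> previous; is_parent \<psi> i j\<rbrakk> \<Longrightarrow> clause_step \<psi> previous (j, \<alpha>)"

definition clause_judgement_proof :: "'v qcbf \<Rightarrow> 'v cl_judgement list \<Rightarrow> bool" where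
  "clause_judgement_proof \<psi> \<pi> \<longleftrightarrow>
     (\<forall>n<length \<pi>. clause_judgement \<psi> (\<pi> ! n) \<and> clause_step \<psi> (set (take n \<pi>)) (\<pi> ! n))"

text \<open>The inserted \<open>0\<close> fixes the width of the empty proof.\<close>

definition clause_proof_width :: "'v cl_judgement list \<Rightarrow> nat" where
  "clause_proof_width \<pi> = Max (insert 0 ((\<lambda>(i, \<alpha>). card (vars \<alpha>)) ` set \<pi>))"


subsection \<open>Structures and constraint judgement proofs\<close>

record ('r, 'b) rel_structure =
  universe :: "'b set"
  arity :: "'r \<Rightarrow> nat"
  interp :: "'r \<Rightarrow> 'b list set"

definition is_structure :: "('r, 'b) rel_structure \<Rightarrow> bool" where
  "is_structure B \<longleftrightarrow> universe B \<noteq> {} \<and>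
     (\<forall>R. interp B R \<subseteq> {t. length t = arity B R \<and> set t \<subseteq> universe B})"

type_synonym ('r, 'v) rel_atom = "'r \<times> 'v list"

definition atom_vars :: "('r, 'v) rel_atom \<Rightarrow> 'v set" where
  "atom_vars = (\<lambda>(R, vs). set vs)"

type_synonym ('r, 'v) qc_formula = "('v, ('r, 'v) rel_atom) qformula"

definition formula_over :: "('r, 'b) rel_structure \<Rightarrow> ('r, 'v) qc_formula \<Rightarrow> bool" where
  "formula_over B \<phi> \<longleftrightarrow> (\<forall>(R, vs)\<in>leaves \<phi>. length vs = arity B R)"

text \<open>
  A map from \<open>V\<close> to the universe is represented by its extensional version, an element of
  \<open>V \<rightarrow>\<^sub>E universe B\<close>, so that distinct elements of a constraint are distinct maps on \<open>V\<close>.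
\<close>

type_synonym ('v, 'b) co_judgement = "index \<times> 'v set \<times> ('v \<Rightarrow> 'b) set"

definition constraint_judgement ::
  "('r, 'v) qc_formula \<Rightarrow> ('r, 'b) rel_structure \<Rightarrow> ('v, 'b) co_judgement \<Rightarrow> bool" where
  "constraint_judgement \<phi> B = (\<lambda>(i, V, F).
     (\<exists>\<chi>. subformula_at i \<phi> = Some \<chi> \<and> V \<subseteq> free atom_vars \<chi>) \<and> F \<subseteq> V \<rightarrow>\<^sub>E universe B)"

definition join ::
  "('r, 'b) rel_structure \<Rightarrow> 'v set \<Rightarrow> ('v \<Rightarrow> 'b) set \<Rightarrow> 'v set \<Rightarrow> ('v \<Rightarrow> 'b) set \<Rightarrow> ('v \<Rightarrow> 'b) set" where
  "join B U\<^sub>1 F\<^sub>1 U\<^sub>2 F\<^sub>2 =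
     {f \<in> U\<^sub>1 \<union> U\<^sub>2 \<rightarrow>\<^sub>E universe B. restrict f U\<^sub>1 \<in> F\<^sub>1 \<and> restrict f U\<^sub>2 \<in> F\<^sub>2}"

definition forall_elim ::
  "('r, 'b) rel_structure \<Rightarrow> 'v \<Rightarrow> 'v set \<Rightarrow> ('v \<Rightarrow> 'b) set \<Rightarrow> ('v \<Rightarrow> 'b) set" where
  "forall_elim B y U F = {f \<in> (U - {y}) \<rightarrow>\<^sub>E universe B. \<forall>b\<in>universe B. f(y := b) \<in> F}"

inductive constraint_step ::
  "('r, 'v) qc_formula \<Rightarrow> ('r, 'b) rel_structure \<Rightarrow> ('v, 'b) co_judgement set \<Rightarrow>
     ('v, 'b) co_judgement \<Rightarrow> bool"
  for \<phi> :: "('r, 'v) qc_formula" and B :: "('r, 'b) rel_structure"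
    and previous :: "('v, 'b) co_judgement set" where
  atom: "subformula_at i \<phi> = Some (Leaf (R, vs))
    \<Longrightarrow> constraint_step \<phi> B previous
          (i, set vs, {f \<in> set vs \<rightarrow>\<^sub>E universe B. map f vs \<in> interp B R})"
| projection: "\<lbrakk>(i, V, F) \<in> previous; U \<subseteq> V\<rbrakk>
    \<Longrightarrow> constraint_step \<phi> B previous (i, U, (\<lambda>f. restrict f U) ` F)"
| join: "\<lbrakk>(i, U\<^sub>1, F\<^sub>1) \<in> previous; (i, U\<^sub>2, F\<^sub>2) \<in> previous\<rbrakk>
    \<Longrightarrow> constraint_step \<phi> B previous (i, U\<^sub>1 \<union> U\<^sub>2, join B U\<^sub>1 F\<^sub>1 U\<^sub>2 F\<^sub>2)"
| upward_flow: "\<lbrakk>(j, V, F) \<in> previous; is_parent \<phi> i j\<rbrakk>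
    \<Longrightarrow> constraint_step \<phi> B previous (i, V, F)"
| forall_elimination: "\<lbrakk>(j, V, F) \<in> previous; y \<in> V; is_parent \<phi> i j;
      subformula_at i \<phi> = Some (Forall y \<chi>); subformula_at j \<phi> = Some \<chi>\<rbrakk>
    \<Longrightarrow> constraint_step \<phi> B previous (i, V - {y}, forall_elim B y V F)"
| downward_flow: "\<lbrakk>(i, V, F) \<in> previous; is_parent \<phi> i j\<rbrakk>
    \<Longrightarrow> constraint_step \<phi> B previous (j, V, F)"

definition constraint_judgement_proof ::
  "('r, 'v) qc_formula \<Rightarrow> ('r, 'b) rel_structure \<Rightarrow> ('v, 'b) co_judgement list \<Rightarrow> bool" where
  "constraint_judgement_proof \<phi> B \<rho> \<longleftrightarrow>
     (\<forall>n<length \<rho>. constraint_judgement \<phi> B (\<rho> ! n) \<and>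
                   constraint_step \<phi> B (set (take n \<rho>)) (\<rho> ! n))"

definition constraint_proof_width :: "('v, 'b) co_judgement list \<Rightarrow> nat" where
  "constraint_proof_width \<rho> = Max (insert 0 ((\<lambda>(i, V, F). card V) ` set \<rho>))"


subsection \<open>QCSP translations\<close>

text \<open>The universe \<open>{0, 1}\<close> is rendered by the truth values, with \<open>False\<close> for \<open>0\<close>.\<close>

definition clause_atom ::
  "('r, bool) rel_structure \<Rightarrow> 'v clause \<Rightarrow> ('r, 'v) rel_atom \<Rightarrow> bool" where
  "clause_atom B \<gamma> = (\<lambda>(R, vs). distinct vs \<and> set vs = vars \<gamma> \<and>
     interp B R = {map f vs | f. f \<in> vars \<gamma> \<rightarrow>\<^sub>E {False, True} \<and> satisfies f \<gamma>})"

text \<open>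
  The relator of the datatype says that \<open>\<psi>\<close> and \<open>\<phi>\<close> have the same shape and the same quantified
  variables, and that corresponding leaves are related by \<open>clause_atom\<close>.
\<close>

definition qcsp_translation ::
  "'v qcbf \<Rightarrow> ('r, 'v) qc_formula \<Rightarrow> ('r, bool) rel_structure \<Rightarrow> bool" where
  "qcsp_translation \<psi> \<phi> B \<longleftrightarrow>
     is_structure B \<and> universe B = {False, True} \<and> formula_over B \<phi> \<and>
     rel_qformula (=) (clause_atom B) \<psi> \<phi>"

end

theory Submission
  imports Defs
begin

text \<open>
  The clause judgement proof is simulated step by step: every rule becomes its constraint
  counterpart, except that resolution on a variable \<open>v\<close> becomes a join followed by a projection
  that removes \<open>v\<close>. This is what costs the factor 2 in the length, and, as the join lives on the
  variables of the resolvent together with \<open>v\<close>, the additional 1 in the width. When the variable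
  \<open>y\<close> of a \<open>\<forall>\<close>-removal does not occur in the clause, the step is an upward flow.
\<close>

section \<open>Transfer between syntax trees of the same shape\<close>

lemma rel_qformula_free:
  assumes "rel_qformula (=) P \<psi> \<phi>" and "\<And>a b. P a b \<Longrightarrow> us a = vs b"
  shows "free us \<psi> = free vs \<phi>"
  using assms(1) by (induction rule: qformula.rel_induct) (auto simp: assms(2))

lemma rel_qformula_children:
  assumes "rel_qformula Q P \<psi> \<phi>"
  shows "list_all2 (rel_qformula Q P) (children \<psi>) (children \<phi>)"
  using assms by (cases rule: qformula.rel_cases) auto

text \<open>The option relator handles two matters at once: it makes the two index sets agree, and
  it passes the leaf relation on to corresponding subformulas.\<close>

lemma rel_qformula_subformula_at:
  assumes "rel_qformula Q P \<psi> \<phi>"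
  shows "rel_option (rel_qformula Q P) (subformula_at i \<psi>) (subformula_at i \<phi>)"
  using assms
proof (induction i arbitrary: \<psi> \<phi>)
  case (Cons d p)
  from rel_qformula_children[OF Cons.prems] show ?case
    by (auto simp: list_all2_conv_all_nth intro: Cons.IH)
qed simp

lemma rel_qformula_subformula_at_Some:
  assumes "rel_qformula Q P \<psi> \<phi>" and "subformula_at i \<psi> = Some \<chi>"
  obtains \<chi>' where "subformula_at i \<phi> = Some \<chi>'" and "rel_qformula Q P \<chi> \<chi>'"
  using rel_qformula_subformula_at[OF assms(1), of i] assms(2)
  by (auto simp: option_rel_Some1)

lemma rel_qformula_indices:
  assumes "rel_qformula Q P \<psi> \<phi>"
  shows "indices \<psi> = indices \<phi>"
  using rel_qformula_subformula_at[OF assms] unfolding indices_def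
  by (metis rel_option_None1 rel_option_None2)

lemma rel_qformula_is_parent:
  assumes "rel_qformula Q P \<psi> \<phi>"
  shows "is_parent \<psi> = is_parent \<phi>"
  by (intro ext) (simp add: is_parent_def rel_qformula_indices[OF assms])

text \<open>Needed to walk from an index \<open>i\<close> to its child \<open>i @ [d]\<close>, since
  paths are consumed from the root while \<open>is_parent\<close> extends them at the far
  end.\<close>

lemma subformula_at_append:
  "subformula_at (p @ q) \<phi> = Option.bind (subformula_at p \<phi>) (subformula_at q)"
  by (induction p arbitrary: \<phi>) auto

section \<open>Clauses: variables and satisfaction under resolution and variable removal\<close>

lemma var_complement [simp]: "var (complement L) = var L"
  by (cases L) auto

lemma literal_true_complement [simp]: "literal_true f (complement L) \<longleftrightarrow> \<not> literal_true f L"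
  by (cases L) auto

lemma literal_true_cong:
  "f (var L) = g (var L) \<Longrightarrow> literal_true f L \<longleftrightarrow> literal_true g L"
  by (cases L) auto

lemma satisfies_cong:
  assumes "\<And>v. v \<in> vars \<alpha> \<Longrightarrow> f v = g v"
  shows "satisfies f \<alpha> \<longleftrightarrow> satisfies g \<alpha>"
  using assms unfolding satisfies_def vars_def
  by (intro bex_cong refl literal_true_cong) auto

lemma satisfies_restrict: "satisfies (restrict f (vars \<alpha>)) \<alpha> \<longleftrightarrow> satisfies f \<alpha>"
  by (rule satisfies_cong) simp

text \<open>Of \<open>L\<close> and \<open>complement L\<close> only one is true under
  \<open>f\<close>, so of two true literals picked from \<open>\<alpha>\<close> and
  \<open>\<beta>\<close> at least one survives the removal.\<close>

lemma satisfies_resolvent: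
  assumes "satisfies f \<alpha>" and "satisfies f \<beta>"
  shows "satisfies f ((\<alpha> - {L}) \<union> (\<beta> - {complement L}))"
proof -
  obtain M N where "M \<in> \<alpha>" "literal_true f M" "N \<in> \<beta>" "literal_true f N"
    using assms by (auto simp: satisfies_def)
  moreover from this have "M \<noteq> L \<or> N \<noteq> complement L"
    by auto
  ultimately show ?thesis
    by (auto simp: satisfies_def)
qed

text \<open>A clause has at most one literal per variable, so no other literal keeps
  \<open>var L\<close> alive.\<close>

lemma vars_remove_literal:
  assumes "is_clause \<alpha>" and "L \<in> \<alpha>"
  shows "vars (\<alpha> - {L}) = vars \<alpha> - {var L}"
  using assms unfolding is_clause_def vars_def by blast

lemma vars_resolvent:
  assumes "is_clause \<alpha>" and "is_clause \<beta>" and "L \<in> \<alpha>" and "complement L \<in> \<beta>"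
  shows "vars ((\<alpha> - {L}) \<union> (\<beta> - {complement L})) = vars \<alpha> \<union> vars \<beta> - {var L}"
proof -
  have "vars ((\<alpha> - {L}) \<union> (\<beta> - {complement L})) = vars (\<alpha> - {L}) \<union> vars (\<beta> - {complement L})"
    by (simp add: vars_def image_Un)
  then show ?thesis
    using vars_remove_literal[OF assms(1,3)] vars_remove_literal[OF assms(2,4)] by auto
qed

lemma vars_remove_variable: "vars (\<alpha> - {Pos y, Neg y}) = vars \<alpha> - {y}"
proof -
  \<comment> \<open>The removed pair consists of all literals on \<open>y\<close>, so exactly
    \<open>y\<close> drops out of the variables.\<close>
  have "{Pos y, Neg y} = {L. var L = y}"
    by (auto, metis literal.exhaust var.simps)
  then show ?thesis
    by (auto simp: vars_def)
qed

text \<open>Some value of \<open>y\<close> falsifies whatever literal on \<open>y\<close> the clause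
  contains; a literal true under that value lies on another variable and ignores the change at
  \<open>y\<close>.\<close>

lemma satisfies_remove_variable:
  assumes "is_clause \<alpha>" and "\<And>b. satisfies (f(y := b)) \<alpha>"
  shows "satisfies f (\<alpha> - {Pos y, Neg y})"
proof -
  \<comment> \<open>The value \<open>Neg y \<in> \<alpha>\<close> is the falsifying one: true if
    \<open>Neg y\<close> occurs, and false otherwise, when only \<open>Pos y\<close> can
    occur.\<close>
  obtain L where L: "L \<in> \<alpha>" "literal_true (f(y := (Neg y \<in> \<alpha>))) L"
    using assms(2)[of "Neg y \<in> \<alpha>"] by (auto simp: satisfies_def)
  have "\<not> (Pos y \<in> \<alpha> \<and> Neg y \<in> \<alpha>)"
    using assms(1) by (force simp: is_clause_def)
  then have "var L \<noteq> y"
    using L by (cases L) auto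
  then have "literal_true f L"
    using L(2) by (cases L) auto
  with L(1) \<open>var L \<noteq> y\<close> show ?thesis
    by (force simp: satisfies_def)
qed

text \<open>Since the universe consists of both truth values, membership in
  \<open>forall_elim\<close> puts every extension \<open>f(y := b)\<close> into
  \<open>F\<close>.\<close>

lemma satisfies_forall_elim:
  fixes B :: "('r, bool) rel_structure"
  assumes "is_clause \<alpha>" and "universe B = {False, True}" and "\<forall>f\<in>F. satisfies f \<alpha>"
  shows "\<forall>f\<in>forall_elim B y U F. satisfies f (\<alpha> - {Pos y, Neg y})"
proof
  fix f
  assume "f \<in> forall_elim B y U F"
  then have "satisfies (f(y := b)) \<alpha>" for b
    using assms(2,3) by (cases b) (auto simp: forall_elim_def)
  then show "satisfies f (\<alpha> - {Pos y, Neg y})"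
    by (rule satisfies_remove_variable[OF assms(1)])
qed

text \<open>A tuple of the relation stems from some \<open>g\<close> satisfying the clause, and
  equality of the tuples along \<open>vs\<close> makes \<open>f\<close> agree with \<open>g\<close>
  on \<open>vars \<gamma>\<close>.\<close>

lemma satisfies_atom:
  assumes "clause_atom B \<gamma> (R, vs)" and "map f vs \<in> interp B R"
  shows "satisfies f \<gamma>"
proof -
  obtain g where "map f vs = map g vs" "satisfies g \<gamma>"
    using assms by (auto simp: clause_atom_def)
  moreover from this assms(1) have "satisfies f \<gamma> \<longleftrightarrow> satisfies g \<gamma>"
    by (intro satisfies_cong) (auto simp: clause_atom_def)
  ultimately show ?thesis by simp
qed

section \<open>Extending proofs at the end, their members and widths\<close>

lemma clause_judgement_proof_snoc:
  "clause_judgement_proof \<psi> (\<pi> @ [x]) \<longleftrightarrow>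
     clause_judgement_proof \<psi> \<pi> \<and> clause_judgement \<psi> x \<and> clause_step \<psi> (set \<pi>) x"
  by (auto simp: clause_judgement_proof_def nth_append less_Suc_eq)

lemma constraint_judgement_proof_snoc:
  "constraint_judgement_proof \<phi> B (\<rho> @ [x]) \<longleftrightarrow>
     constraint_judgement_proof \<phi> B \<rho> \<and> constraint_judgement \<phi> B x \<and>
     constraint_step \<phi> B (set \<rho>) x"
  by (auto simp: constraint_judgement_proof_def nth_append less_Suc_eq)

lemma clause_judgement_proof_member:
  "clause_judgement_proof \<psi> \<pi> \<Longrightarrow> x \<in> set \<pi> \<Longrightarrow> clause_judgement \<psi> x"
  by (auto simp: clause_judgement_proof_def in_set_conv_nth)

lemma constraint_judgement_proof_member:
  "constraint_judgement_proof \<phi> B \<rho> \<Longrightarrow> x \<in> set \<rho> \<Longrightarrow> constraint_judgement \<phi> B x"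
  by (auto simp: constraint_judgement_proof_def in_set_conv_nth)

lemma clause_proof_width_le_iff:
  "clause_proof_width \<pi> \<le> w \<longleftrightarrow> (\<forall>(i, \<alpha>)\<in>set \<pi>. card (vars \<alpha>) \<le> w)"
  by (auto simp: clause_proof_width_def)

lemma constraint_proof_width_le_iff:
  "constraint_proof_width \<rho> \<le> w \<longleftrightarrow> (\<forall>(i, V, F)\<in>set \<rho>. card V \<le> w)"
  by (auto simp: constraint_proof_width_def)

section \<open>Simulation of clause judgements by constraint judgements\<close>

definition entails :: "('v, bool) co_judgement set \<Rightarrow> 'v cl_judgement \<Rightarrow> bool" where
  "entails J = (\<lambda>(i, \<alpha>). \<exists>F. (i, vars \<alpha>, F) \<in> J \<and> (\<forall>f\<in>F. satisfies f \<alpha>))"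

lemma entails_mono: "entails J x \<Longrightarrow> J \<subseteq> K \<Longrightarrow> entails K x"
  unfolding entails_def by blast

text \<open>The invariant \<open>entails\<close> fixes the scope as exactly the clause's variables,
  so premises are available in the form the constraint rules need. The bound on the new scopes
  refers to the width of \<open>x\<close> alone, hence the excess of 1 does not accumulate along the
  proof.\<close>

lemma simulate_clause_step:
  fixes B :: "('r, bool) rel_structure"
  assumes tr: "qcsp_translation \<psi> \<phi> B"
    and step: "clause_step \<psi> (set \<pi>) x"
    and judg: "clause_judgement \<psi> x"
    and prem: "\<And>y. y \<in> set \<pi> \<Longrightarrow> clause_judgement \<psi> y \<and> entails (set \<rho>) y"
    and proof\<rho>: "constraint_judgement_proof \<phi> B \<rho>"
  obtains \<delta> where "constraint_judgement_proof \<phi> B (\<rho> @ \<delta>)" and "length \<delta> \<le> 2"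
    and "\<forall>(i, V, F)\<in>set \<delta>. card V \<le> card (vars (snd x)) + 1"
    and "entails (set \<delta>) x"
proof -
  have rel: "rel_qformula (=) (clause_atom B) \<psi> \<phi>" and univ: "universe B = {False, True}"
    using tr by (auto simp: qcsp_translation_def)
  note parent = rel_qformula_is_parent[OF rel]
  obtain i \<alpha> where x: "x = (i, \<alpha>)"
    by fastforce
  obtain \<chi> where \<chi>: "subformula_at i \<psi> = Some \<chi>" "vars \<alpha> \<subseteq> free vars \<chi>"
    using judg by (auto simp: x clause_judgement_def)
  obtain \<chi>' where \<chi>': "subformula_at i \<phi> = Some \<chi>'" and rel\<chi>: "rel_qformula (=) (clause_atom B) \<chi> \<chi>'"
    using rel_qformula_subformula_at_Some[OF rel \<chi>(1)] .
  have free: "free vars \<eta> = free atom_vars \<eta>'" if "rel_qformula (=) (clause_atom B) \<eta> \<eta>'" for \<eta> \<eta>'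
    using that by (rule rel_qformula_free) (auto simp: clause_atom_def atom_vars_def)
  \<comment> \<open>Corresponding subformulas have the same free variables, so scope conditions at
    \<open>i\<close> can be checked in \<open>\<psi>\<close>.\<close>
  have judgI: "constraint_judgement \<phi> B (i, V, F)"
    if "V \<subseteq> free vars \<chi>" "F \<subseteq> V \<rightarrow>\<^sub>E universe B" for V F
    using that \<chi>' free[OF rel\<chi>] by (auto simp: constraint_judgement_def)
  \<comment> \<open>Saves the rule for the obtained \<open>\<delta>\<close> before the local
    assumptions below rebind \<open>that\<close>.\<close>
  note result = that
  \<comment> \<open>Serves every rule except resolution: one appended judgement is enough.\<close>
  have single: thesis
    if "constraint_step \<phi> B (set \<rho>) (i, vars \<alpha>, F)" "F \<subseteq> vars \<alpha> \<rightarrow>\<^sub>E universe B"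
      "\<forall>f\<in>F. satisfies f \<alpha>" for F
    using that proof\<rho> judgI[OF \<chi>(2)]
    by (intro result[of "[(i, vars \<alpha>, F)]"])
       (auto simp: x entails_def constraint_judgement_proof_snoc)
  have premE: "\<exists>F. (j, vars \<beta>, F) \<in> set \<rho> \<and> (\<forall>f\<in>F. satisfies f \<beta>) \<and> F \<subseteq> vars \<beta> \<rightarrow>\<^sub>E universe B
      \<and> is_clause \<beta> \<and> (\<exists>\<eta>. subformula_at j \<psi> = Some \<eta> \<and> vars \<beta> \<subseteq> free vars \<eta>)"
    if mem: "(j, \<beta>) \<in> set \<pi>" for j \<beta>
  proof -
    obtain F where F: "(j, vars \<beta>, F) \<in> set \<rho>" "\<forall>f\<in>F. satisfies f \<beta>"
      using prem[OF mem] by (auto simp: entails_def)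
    moreover have "F \<subseteq> vars \<beta> \<rightarrow>\<^sub>E universe B"
      using constraint_judgement_proof_member[OF proof\<rho> F(1)]
      by (simp add: constraint_judgement_def)
    ultimately show ?thesis
      using prem[OF mem] by (auto simp: clause_judgement_def)
  qed
  from step[unfolded x] show thesis
  proof cases
    case clause
    with \<chi>(1) have "\<chi> = Leaf \<alpha>"
      by simp
    with rel\<chi> obtain R vs where leaf: "\<chi>' = Leaf (R, vs)" and at: "clause_atom B \<alpha> (R, vs)"
      by (cases \<chi>') auto
    have vs: "set vs = vars \<alpha>"
      using at by (simp add: clause_atom_def)
    show thesis
      using constraint_step.atom[OF \<chi>'[unfolded leaf], of B "set \<rho>"] satisfies_atom[OF at]
      by (intro single[of "{f \<in> set vs \<rightarrow>\<^sub>E universe B. map f vs \<in> interp B R}"])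
         (auto simp: vs)
  next
    case (resolve \<beta>\<^sub>1 \<beta>\<^sub>2)
    obtain L where L: "L \<in> \<beta>\<^sub>1" "complement L \<in> \<beta>\<^sub>2"
      and \<alpha>: "\<alpha> = (\<beta>\<^sub>1 - {L}) \<union> (\<beta>\<^sub>2 - {complement L})"
      using resolve(3) by (auto simp: resolvent_def)
    obtain F\<^sub>1 where F\<^sub>1: "(i, vars \<beta>\<^sub>1, F\<^sub>1) \<in> set \<rho>" "\<forall>f\<in>F\<^sub>1. satisfies f \<beta>\<^sub>1"
      and cl1: "is_clause \<beta>\<^sub>1" "vars \<beta>\<^sub>1 \<subseteq> free vars \<chi>"
      using premE[OF resolve(1)] \<chi>(1) by auto
    obtain F\<^sub>2 where F\<^sub>2: "(i, vars \<beta>\<^sub>2, F\<^sub>2) \<in> set \<rho>" "\<forall>f\<in>F\<^sub>2. satisfies f \<beta>\<^sub>2"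
      and cl2: "is_clause \<beta>\<^sub>2" "vars \<beta>\<^sub>2 \<subseteq> free vars \<chi>"
      using premE[OF resolve(2)] \<chi>(1) by auto
    define U where "U = vars \<beta>\<^sub>1 \<union> vars \<beta>\<^sub>2"
    define G where "G = Defs.join B (vars \<beta>\<^sub>1) F\<^sub>1 (vars \<beta>\<^sub>2) F\<^sub>2"
    \<comment> \<open>Both parents being clauses, the pivot variable vanishes entirely, so
      projecting the join to \<open>vars \<alpha>\<close> drops just this variable.\<close>
    have vars\<alpha>: "vars \<alpha> = U - {var L}"
      unfolding \<alpha> U_def using cl1(1) cl2(1) L by (rule vars_resolvent)
    then have "card U \<le> card (vars \<alpha>) + 1"
      using card_Diff1_le[of U "var L"] by (cases "var L \<in> U") (auto simp: card_Diff_singleton)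
    have G: "G \<subseteq> U \<rightarrow>\<^sub>E universe B"
      by (auto simp: G_def U_def join_def)
    \<comment> \<open>The restrictions of \<open>f\<close> lie in \<open>F\<^sub>1\<close> and
      \<open>F\<^sub>2\<close>; as satisfaction depends only on a clause's own variables,
      \<open>f\<close> satisfies both parents and thus the resolvent.\<close>
    have "satisfies f \<alpha>" if "f \<in> G" for f
      unfolding \<alpha> using that F\<^sub>1(2) F\<^sub>2(2)
      by (intro satisfies_resolvent) (auto simp: G_def join_def satisfies_restrict dest: bspec)
    then have sat: "\<forall>f\<in>(\<lambda>f. restrict f (vars \<alpha>)) ` G. satisfies f \<alpha>"
      by (auto simp: satisfies_restrict)
    have 1: "constraint_judgement_proof \<phi> B (\<rho> @ [(i, U, G)])"
      using proof\<rho> constraint_step.join[OF F\<^sub>1(1) F\<^sub>2(1), of \<phi> B] judgI[OF _ G] cl1(2) cl2(2)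
      by (auto simp: constraint_judgement_proof_snoc U_def G_def)
    \<comment> \<open>The premise of the projection is the join just appended.\<close>
    have 2: "constraint_step \<phi> B (set (\<rho> @ [(i, U, G)]))
        (i, vars \<alpha>, (\<lambda>f. restrict f (vars \<alpha>)) ` G)"
      by (rule constraint_step.projection[of _ U]) (auto simp: vars\<alpha>)
    have "(\<lambda>f. restrict f (vars \<alpha>)) ` G \<subseteq> vars \<alpha> \<rightarrow>\<^sub>E universe B"
      using G vars\<alpha> by (auto simp only: restrict_PiE_iff image_subset_iff)
    from judgI[OF \<chi>(2) this] 1 2
    have "constraint_judgement_proof \<phi> B
        ((\<rho> @ [(i, U, G)]) @ [(i, vars \<alpha>, (\<lambda>f. restrict f (vars \<alpha>)) ` G)])"
      by (simp only: constraint_judgement_proof_snoc)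
    then show thesis
      using sat \<open>card U \<le> card (vars \<alpha>) + 1\<close>
      by (intro result[of "[(i, U, G), (i, vars \<alpha>, (\<lambda>f. restrict f (vars \<alpha>)) ` G)]"])
         (auto simp: x entails_def)
  next
    case (upward_flow j)
    \<comment> \<open>A flow reuses the premise's constraint unchanged; admissibility of its scope
      at the new index comes from the clause judgement \<open>x\<close>, through
      \<open>single\<close>.\<close>
    obtain F where "(j, vars \<alpha>, F) \<in> set \<rho>" "\<forall>f\<in>F. satisfies f \<alpha>" "F \<subseteq> vars \<alpha> \<rightarrow>\<^sub>E universe B"
      using premE[OF upward_flow(1)] by auto
    with upward_flow(2) show thesis
      by (intro single[of F]) (auto simp: parent intro: constraint_step.upward_flow)
  next
    case (forall_removal j \<beta> y \<eta>)
    obtain F where F: "(j, vars \<beta>, F) \<in> set \<rho>" "\<forall>f\<in>F. satisfies f \<beta>"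
      "F \<subseteq> vars \<beta> \<rightarrow>\<^sub>E universe B" and cl: "is_clause \<beta>"
      using premE[OF forall_removal(2)] by auto
    have vars\<alpha>: "vars \<alpha> = vars \<beta> - {y}"
      using forall_removal(1) by (simp add: vars_remove_variable)
    show thesis
    \<comment> \<open>The rule \<open>forall_elimination\<close> demands \<open>y\<close> in the
      scope, whereas removal from a clause is allowed for any \<open>y\<close>.\<close>
    proof (cases "y \<in> vars \<beta>")
      case True
      obtain \<eta>' where \<eta>': "subformula_at i \<phi> = Some (Forall y \<eta>')"
        using rel\<chi> forall_removal(4) \<chi> \<chi>' by (cases \<chi>') auto
      \<comment> \<open>Here \<open>j\<close> has the form \<open>i @ [d]\<close>, and a quantified
        formula has a single child, which forces \<open>d = 0\<close>.\<close>
      then have "subformula_at j \<phi> = Some \<eta>'"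
        using forall_removal(3)
        by (auto simp: parent is_parent_def indices_def subformula_at_append split: if_splits)
      with F(1) True \<eta>' forall_removal(3)
      have "constraint_step \<phi> B (set \<rho>) (i, vars \<alpha>, forall_elim B y (vars \<beta>) F)"
        unfolding vars\<alpha> parent by (intro constraint_step.forall_elimination)
      moreover have "forall_elim B y (vars \<beta>) F \<subseteq> vars \<alpha> \<rightarrow>\<^sub>E universe B"
        unfolding vars\<alpha> forall_elim_def by blast
      moreover have "\<forall>f\<in>forall_elim B y (vars \<beta>) F. satisfies f \<alpha>"
        unfolding forall_removal(1) using cl univ F(2) by (rule satisfies_forall_elim)
      ultimately show thesis
        by (rule single)
    next
      case False
      then have "Pos y \<notin> \<beta>" "Neg y \<notin> \<beta>"
        using imageI[of _ \<beta> var] by (fastforce simp: vars_def)+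
      then have "\<alpha> = \<beta>"
        using forall_removal(1) by simp
      moreover have "constraint_step \<phi> B (set \<rho>) (i, vars \<beta>, F)"
        using F(1) forall_removal(3) unfolding parent by (rule constraint_step.upward_flow)
      ultimately show thesis
        using F(2,3) by (intro single[of F]) simp_all
    qed
  next
    case (downward_flow j)
    obtain F where "(j, vars \<alpha>, F) \<in> set \<rho>" "\<forall>f\<in>F. satisfies f \<alpha>" "F \<subseteq> vars \<alpha> \<rightarrow>\<^sub>E universe B"
      using premE[OF downward_flow(1)] by auto
    with downward_flow(2) show thesis
      by (intro single[of F]) (auto simp: parent intro: constraint_step.downward_flow)
  qed
qed

text \<open>Induction appends judgements on the right. Here \<open>w\<close> is any upper bound
  rather than the exact width, because a prefix may be narrower than the whole proof.\<close>

lemma simulate_clause_judgement_proof: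
  fixes B :: "('r, bool) rel_structure"
  assumes "qcsp_translation \<psi> \<phi> B" and "clause_judgement_proof \<psi> \<pi>"
    and "clause_proof_width \<pi> \<le> w"
  shows "\<exists>\<rho>. constraint_judgement_proof \<phi> B \<rho> \<and> length \<rho> \<le> 2 * length \<pi> \<and>
             constraint_proof_width \<rho> \<le> w + 1 \<and> (\<forall>x\<in>set \<pi>. entails (set \<rho>) x)"
  using assms(2,3)
proof (induction \<pi> rule: rev_induct)
  case Nil
  show ?case
    by (intro exI[of _ "[]"]) (simp add: constraint_judgement_proof_def constraint_proof_width_def)
next
  case (snoc x \<pi>)
  have \<pi>: "clause_judgement_proof \<psi> \<pi>" "clause_judgement \<psi> x" "clause_step \<psi> (set \<pi>) x"
    using snoc.prems(1) by (simp_all add: clause_judgement_proof_snoc)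
  have w: "clause_proof_width \<pi> \<le> w" "card (vars (snd x)) \<le> w"
    using snoc.prems(2) by (auto simp: clause_proof_width_le_iff)
  obtain \<rho> where \<rho>: "constraint_judgement_proof \<phi> B \<rho>" "length \<rho> \<le> 2 * length \<pi>"
    "constraint_proof_width \<rho> \<le> w + 1" "\<forall>x\<in>set \<pi>. entails (set \<rho>) x"
    using snoc.IH[OF \<pi>(1) w(1)] by blast
  obtain \<delta> where \<delta>: "constraint_judgement_proof \<phi> B (\<rho> @ \<delta>)" "length \<delta> \<le> 2"
    "\<forall>(i, V, F)\<in>set \<delta>. card V \<le> card (vars (snd x)) + 1" "entails (set \<delta>) x"
    using simulate_clause_step[OF assms(1) \<pi>(3,2) _ \<rho>(1)]
      clause_judgement_proof_member[OF \<pi>(1)] \<rho>(4) by metis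
  \<comment> \<open>Old scopes are bounded by induction; new ones exceed the width of
    \<open>x\<close>, itself at most \<open>w\<close>, by at most 1.\<close>
  have "constraint_proof_width (\<rho> @ \<delta>) \<le> w + 1"
    using \<rho>(3) \<delta>(3) w(2) by (fastforce simp: constraint_proof_width_le_iff)
  then show ?case
    using \<rho> \<delta> by (intro exI[of _ "\<rho> @ \<delta>"]) (auto intro: entails_mono)
qed

theorem theoremA1:
  fixes \<psi> :: "'v qcbf"
    and \<phi> :: "('r, 'v) qc_formula"
    and B :: "('r, bool) rel_structure"
    and \<pi> :: "'v cl_judgement list"
    and s w :: nat
  assumes "qcbf_instance \<psi>"
    and "qcsp_translation \<psi> \<phi> B"
    and "clause_judgement_proof \<psi> \<pi>"
    and "length \<pi> = s"
    and "clause_proof_width \<pi> = w"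
  shows "\<exists>\<rho>. constraint_judgement_proof \<phi> B \<rho> \<and>
             length \<rho> \<le> 2 * s \<and>
             constraint_proof_width \<rho> \<le> w + 1 \<and>
             (\<forall>(i, \<alpha>)\<in>set \<pi>. \<exists>F. (i, vars \<alpha>, F) \<in> set \<rho> \<and> (\<forall>f\<in>F. satisfies f \<alpha>))"
  using simulate_clause_judgement_proof[OF assms(2,3), of w] assms(4,5)
  unfolding entails_def by simp

end
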